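(* Let $\mathcal{C}$ be a W-chordal clutter with minimum edge cardinality $d$. Then the simplicial complex $\mathcal{I}(c_d(\mathcal{C}))^\vee$ is strongly shellable.
   Context: A clutter $\mathcal{C}$ with finite vertex set $\mathcal{V}(\mathcal{C})$ consists of a collection $\mathcal{E}(\mathcal{C})$ of nonempty subsets of $\mathcal{V}(\mathcal{C})$ (edges), none of which is included in another. For a vertex $v$: the deletion $\mathcal{C}\setminus v$ is the clutter on $\mathcal{V}(\mathcal{C})\setminus\{v\}$ with edges $\{e\in\mathcal{E}(\mathcal{C}): v\notin e\}$; the contraction $\mathcal{C}/v$ is the clutter on $\mathcal{V}(\mathcal{C})\setminus\{v\}$ whose edges are the inclusion-minimal sets of $\{e\setminus\{v\}: e\in\mathcal{E}(\mathcal{C})\}$ (if $\{v\}$ is an edge, the only edge of $\mathcal{C}/v$ is $\varnothing$; such degenerate clutters are allowed as minors). A minor of $\mathcal{C}$ is a clutter obtained from $\mathcal{C}$ by repeated (possibly zero) deletions and/or contractions. A vertex $v$ of a clutter is simplicial if for every two distinct edges $e_1,e_2$ containing $v$ there is a third edge $e_3$ such that $e_3\subseteq(e_1\cup e_2)\setminus\{v\}$. A clutter is W-chordal if every minor of it (with nonempty vertex set) has a simplicial vertex. For an integer $d$, $c_d(\mathcal{C})$ is the clutter on $\mathcal{V}(\mathcal{C})$ with edge set $\{e\subseteq\mathcal{V}(\mathcal{C}): |e|=d,\ e\notin\mathcal{E}(\mathcal{C})\}$. The independence complex $\mathcal{I}(\mathcal{C})$ of a clutter is the simplicial complex of all subsets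 of $\mathcal{V}(\mathcal{C})$ containing no edge of $\mathcal{C}$. For a simplicial complex $\Delta$ on $V$, the Alexander dual is $\Delta^\vee=\{V\setminus F: F\subseteq V, F\notin\Delta\}$. Thus $\mathcal{I}(c_d(\mathcal{C}))^\vee$ is the pure complex whose facets are the sets $\mathcal{V}(\mathcal{C})\setminus e$ with $e\in\mathcal{E}(c_d(\mathcal{C}))$. A simplicial complex is strongly shellable if its facets can be arranged in a linear order $F_1,\dots,F_t$ such that for each pair $i<j$ there exists $k<j$ with $|F_j\setminus F_k|=1$ and $F_i\cap F_j\subseteq F_k\subseteq F_i\cup F_j$. The complex with no faces is (vacuously) strongly shellable. *)

theory Defs
  imports Main
begin

text \<open>A set system: a vertex set and a collection of edges. Clutters are the set systems
  satisfying \<open>clutter\<close>; since a contraction may have the empty set as its only edge,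
  the minor operations are defined on set systems and such degenerate clutters are admitted
  as minors.\<close>

record 'a set_system =
  verts :: "'a set"
  edges :: "'a set set"

definition clutter :: "'a set_system \<Rightarrow> bool" where
  "clutter C \<longleftrightarrow> finite (verts C) \<and> (\<forall>e\<in>edges C. e \<noteq> {} \<and> e \<subseteq> verts C) \<and>
     (\<forall>e\<in>edges C. \<forall>f\<in>edges C. e \<subseteq> f \<longrightarrow> e = f)"

definition minimal_sets :: "'a set set \<Rightarrow> 'a set set" where
  "minimal_sets S = {e \<in> S. \<forall>f\<in>S. f \<subseteq> e \<longrightarrow> f = e}"

definition deletion :: "'a set_system \<Rightarrow> 'a \<Rightarrow> 'a set_system" where
  "deletion C v = \<lparr>verts = verts C - {v}, edges = {e \<in> edges C. v \<notin> e}\<rparr>"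

definition contraction :: "'a set_system \<Rightarrow> 'a \<Rightarrow> 'a set_system" where
  "contraction C v =
     \<lparr>verts = verts C - {v}, edges = minimal_sets ((\<lambda>e. e - {v}) ` edges C)\<rparr>"

inductive minor_of :: "'a set_system \<Rightarrow> 'a set_system \<Rightarrow> bool" for C where
  refl: "minor_of C C"
| del: "minor_of C M \<Longrightarrow> v \<in> verts M \<Longrightarrow> minor_of C (deletion M v)"
| contr: "minor_of C M \<Longrightarrow> v \<in> verts M \<Longrightarrow> minor_of C (contraction M v)"

definition simplicial_vertex :: "'a set_system \<Rightarrow> 'a \<Rightarrow> bool" where
  "simplicial_vertex C v \<longleftrightarrow> v \<in> verts C \<and>
     (\<forall>e1\<in>edges C. \<forall>e2\<in>edges C. e1 \<noteq> e2 \<and> v \<in> e1 \<and> v \<in> e2 \<longrightarrow>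
        (\<exists>e3\<in>edges C. e3 \<noteq> e1 \<and> e3 \<noteq> e2 \<and> e3 \<subseteq> (e1 \<union> e2) - {v}))"

definition W_chordal :: "'a set_system \<Rightarrow> bool" where
  "W_chordal C \<longleftrightarrow>
     (\<forall>M. minor_of C M \<and> verts M \<noteq> {} \<longrightarrow> (\<exists>v. simplicial_vertex M v))"

definition d_complement :: "nat \<Rightarrow> 'a set_system \<Rightarrow> 'a set_system" where
  "d_complement d C =
     \<lparr>verts = verts C, edges = {e. e \<subseteq> verts C \<and> card e = d \<and> e \<notin> edges C}\<rparr>"

text \<open>A simplicial complex is given by its set of faces; the complex with no faces, \<open>{}\<close>, is
  distinct from \<open>{{}}\<close>.\<close>

definition simplicial_complex :: "'a set \<Rightarrow> 'a set set \<Rightarrow> bool" where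
  "simplicial_complex V \<Delta> \<longleftrightarrow>
     finite V \<and> \<Delta> \<subseteq> Pow V \<and> (\<forall>F\<in>\<Delta>. \<forall>G. G \<subseteq> F \<longrightarrow> G \<in> \<Delta>)"

definition independence_complex :: "'a set_system \<Rightarrow> 'a set set" where
  "independence_complex C = {F. F \<subseteq> verts C \<and> (\<forall>e\<in>edges C. \<not> e \<subseteq> F)}"

definition alexander_dual :: "'a set \<Rightarrow> 'a set set \<Rightarrow> 'a set set" where
  "alexander_dual V \<Delta> = {V - F | F. F \<subseteq> V \<and> F \<notin> \<Delta>}"

definition facets :: "'a set set \<Rightarrow> 'a set set" where
  "facets \<Delta> = {F \<in> \<Delta>. \<forall>G\<in>\<Delta>. F \<subseteq> G \<longrightarrow> F = G}"

definition strongly_shellable :: "'a set set \<Rightarrow> bool" where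
  "strongly_shellable \<Delta> \<longleftrightarrow>
     (\<exists>Fs. distinct Fs \<and> set Fs = facets \<Delta> \<and>
        (\<forall>j < length Fs. \<forall>i < j. \<exists>k < j.
           card (Fs ! j - Fs ! k) = 1 \<and>
           Fs ! i \<inter> Fs ! j \<subseteq> Fs ! k \<and> Fs ! k \<subseteq> Fs ! i \<union> Fs ! j))"

lemma simplicial_complex_independence_complex:
  assumes "finite (verts C)"
  shows "simplicial_complex (verts C) (independence_complex C)"
  using assms unfolding simplicial_complex_def independence_complex_def by blast

lemma simplicial_complex_alexander_dual:
  assumes "simplicial_complex V \<Delta>"
  shows "simplicial_complex V (alexander_dual V \<Delta>)"
  unfolding simplicial_complex_def
proof (intro conjI ballI allI impI)
  show "finite V" using assms by (simp add: simplicial_complex_def)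
  show "alexander_dual V \<Delta> \<subseteq> Pow V" by (auto simp: alexander_dual_def)
  fix F G assume F: "F \<in> alexander_dual V \<Delta>" and G: "G \<subseteq> F"
  from F obtain A where A: "F = V - A" "A \<subseteq> V" "A \<notin> \<Delta>" by (auto simp: alexander_dual_def)
  have "A \<subseteq> V - G" and "G = V - (V - G)" using A G by auto
  moreover have "V - G \<notin> \<Delta>"
    using assms A \<open>A \<subseteq> V - G\<close> unfolding simplicial_complex_def by blast
  ultimately show "G \<in> alexander_dual V \<Delta>" unfolding alexander_dual_def by blast
qed

lemma facets_alexander_dual_d_complement:
  assumes "finite (verts C)"
  shows "facets (alexander_dual (verts C) (independence_complex (d_complement d C))) =
    (\<lambda>e. verts C - e) ` edges (d_complement d C)"
proof -
  let ?V = "verts C" and ?E = "edges (d_complement d C)"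
  let ?D = "alexander_dual ?V (independence_complex (d_complement d C))"
  have E: "e \<subseteq> ?V" "card e = d" if "e \<in> ?E" for e
    using that by (auto simp: d_complement_def)
  have D: "G \<in> ?D \<longleftrightarrow> (\<exists>e\<in>?E. G \<subseteq> ?V - e)" for G
  proof
    assume "G \<in> ?D"
    then obtain A where "G = ?V - A" "A \<subseteq> ?V" "A \<notin> independence_complex (d_complement d C)"
      by (auto simp: alexander_dual_def)
    then show "\<exists>e\<in>?E. G \<subseteq> ?V - e"
      by (auto simp: independence_complex_def d_complement_def)
  next
    assume "\<exists>e\<in>?E. G \<subseteq> ?V - e"
    then obtain e where e: "e \<in> ?E" "G \<subseteq> ?V - e" by blast
    then have "G = ?V - (?V - G)" "e \<subseteq> ?V - G" using E by blast+
    moreover have "?V - G \<notin> independence_complex (d_complement d C)"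
      using e(1) \<open>e \<subseteq> ?V - G\<close> by (auto simp: independence_complex_def)
    ultimately show "G \<in> ?D" unfolding alexander_dual_def by blast
  qed
  have eq: "e = f" if "e \<in> ?E" "f \<in> ?E" "?V - e \<subseteq> ?V - f" for e f
  proof -
    have "f \<subseteq> e" using that E[of f] by blast
    moreover have "finite e" using E(1)[OF that(1)] assms finite_subset by blast
    ultimately show ?thesis using E that card_subset_eq by metis
  qed
  show ?thesis
  proof (intro set_eqI iffI)
    fix F assume F: "F \<in> facets ?D"
    then have "F \<in> ?D" by (simp add: facets_def)
    then obtain e where e: "e \<in> ?E" "F \<subseteq> ?V - e" using D by metis
    have "?V - e \<in> ?D" using D e(1) by (metis order_refl)
    then have "F = ?V - e" using F e(2) by (simp add: facets_def)
    then show "F \<in> (\<lambda>e. ?V - e) ` ?E" using e(1) by (rule image_eqI)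
  next
    fix F assume "F \<in> (\<lambda>e. ?V - e) ` ?E"
    then obtain e where e: "e \<in> ?E" "F = ?V - e" by (rule imageE) simp
    have "F = G" if "G \<in> ?D" "F \<subseteq> G" for G
    proof -
      obtain f where f: "f \<in> ?E" "G \<subseteq> ?V - f" using D \<open>G \<in> ?D\<close> by metis
      have "?V - e \<subseteq> ?V - f" using e(2) f(2) that(2) by (metis order_trans)
      with e(1) f(1) have "e = f" by (rule eq)
      with e(2) f(2) that(2) show ?thesis by (simp add: subset_antisym)
    qed
    moreover have "F \<in> ?D" using D e by (metis order_refl)
    ultimately show "F \<in> facets ?D" by (simp add: facets_def)
  qed
qed

end

theory Submission
  imports Defs
begin

text \<open>Taking complements of facets, it suffices to order the \<open>d\<close>-sets that are not edges so that
  for \<open>i < j\<close> some earlier set arises from the \<open>j\<close>-th one by exchanging a single element and lies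
  between the \<open>i\<close>-th and the \<open>j\<close>-th.  Induct on the vertices, requiring only that all edges have
  size at least \<open>d\<close>.  For a simplicial vertex \<open>v\<close>, list first the non-edges through \<open>v\<close> (the
  \<open>(d - 1)\<close>-non-edges of the contraction, with \<open>v\<close> added) and then those avoiding \<open>v\<close> (the
  non-edges of the deletion).  Let \<open>x\<close> be in the first and \<open>y\<close> in the second part.  If
  \<open>y - x = {u}\<close>, then \<open>x = y - u + v\<close> is already an exchange.  Otherwise take distinct
  \<open>u, u' \<in> y - x\<close>: were \<open>y - u + v\<close> and \<open>y - u' + v\<close> both edges, simpliciality of \<open>v\<close> would
  give an edge inside \<open>y\<close>, which by size is \<open>y\<close>.\<close>

text \<open>The strong shelling condition for facets \<open>V - x\<close>, \<open>V - y\<close>,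
  \<open>V - z\<close> in the roles \<open>i\<close>, \<open>j\<close>, \<open>k\<close>, read on
  complements: the difference becomes \<open>z - y\<close>, and the two inclusions trade
  places.\<close>

definition exchange :: "'a set \<Rightarrow> 'a set \<Rightarrow> 'a set \<Rightarrow> bool" where
  "exchange x y z \<longleftrightarrow> card (z - y) = 1 \<and> x \<inter> y \<subseteq> z \<and> z \<subseteq> x \<union> y"

definition exchange_order :: "'a set list \<Rightarrow> bool" where
  "exchange_order es \<longleftrightarrow> distinct es \<and>
     (\<forall>j < length es. \<forall>i < j. \<exists>k < j. exchange (es ! i) (es ! j) (es ! k))"

text \<open>A pair inside one list keeps the witness from that list. For a pair across the lists,
  any witness in \<open>xs\<close> precedes all of \<open>ys\<close>, so \<open>mixed\<close> need
  not mention positions.\<close>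

lemma exchange_order_append:
  assumes xs: "exchange_order xs" and ys: "exchange_order ys"
    and mixed: "\<And>x y. x \<in> set xs \<Longrightarrow> y \<in> set ys \<Longrightarrow> \<exists>z\<in>set xs. exchange x y z"
    and disj: "set xs \<inter> set ys = {}"
  shows "exchange_order (xs @ ys)"
  unfolding exchange_order_def
proof (intro conjI allI impI)
  show "distinct (xs @ ys)" using xs ys disj by (simp add: exchange_order_def)
  fix j i assume j: "j < length (xs @ ys)" and i: "i < j"
  let ?n = "length xs"
  consider "j < ?n" | "j \<ge> ?n" "i < ?n" | "i \<ge> ?n" by linarith
  then show "\<exists>k<j. exchange ((xs @ ys) ! i) ((xs @ ys) ! j) ((xs @ ys) ! k)"
  proof cases
    case 1
    then obtain k where "k < j" "exchange (xs ! i) (xs ! j) (xs ! k)"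
      using xs i unfolding exchange_order_def by blast
    with 1 i show ?thesis by (auto simp: nth_append intro!: exI[of _ k])
  next
    case 2
    then have "xs ! i \<in> set xs" "ys ! (j - ?n) \<in> set ys" using j by auto
    then obtain k where "k < ?n" "exchange (xs ! i) (ys ! (j - ?n)) (xs ! k)"
      using mixed by (metis in_set_conv_nth)
    with 2 show ?thesis by (auto simp: nth_append intro!: exI[of _ k])
  next
    case 3
    then have "j - ?n < length ys" "i - ?n < j - ?n" using j i by auto
    then obtain k where "k < j - ?n" "exchange (ys ! (i - ?n)) (ys ! (j - ?n)) (ys ! k)"
      using ys unfolding exchange_order_def by blast
    with 3 i show ?thesis by (auto simp: nth_append intro!: exI[of _ "?n + k"])
  qed
qed

lemma exchange_order_map_insert:
  assumes "exchange_order es" and v: "\<And>e. e \<in> set es \<Longrightarrow> v \<notin> e"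
  shows "exchange_order (map (insert v) es)"
proof -
  have "inj_on (insert v) (set es)" by (rule inj_onI) (metis v insert_ident)
  moreover have "exchange (insert v x) (insert v y) (insert v z)"
    if "exchange x y z" "z \<in> set es" for x y z
  proof -
    \<comment> \<open>The cardinality condition survives because \<open>v\<close> is not in
      \<open>z\<close>.\<close>
    have "insert v z - insert v y = z - y" using v that(2) by auto
    then show ?thesis using that(1) unfolding exchange_def by auto
  qed
  ultimately show ?thesis
    using assms(1) unfolding exchange_order_def
    by (auto simp: distinct_map) (metis less_trans nth_map nth_mem)
qed

lemma strongly_shellable_complements:
  assumes "exchange_order es" and sub: "\<And>e. e \<in> set es \<Longrightarrow> e \<subseteq> V"
    and "facets \<Delta> = (\<lambda>e. V - e) ` set es"
  shows "strongly_shellable \<Delta>"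
  unfolding strongly_shellable_def
proof (intro exI[of _ "map (\<lambda>e. V - e) es"] conjI allI impI)
  have "inj_on (\<lambda>e. V - e) (set es)" by (rule inj_onI) (metis sub double_diff order_refl)
  then show "distinct (map (\<lambda>e. V - e) es)"
    using assms(1) by (simp add: distinct_map exchange_order_def)
  show "set (map (\<lambda>e. V - e) es) = facets \<Delta>" using assms(3) by simp
  fix j i assume j: "j < length (map (\<lambda>e. V - e) es)" and i: "i < j"
  then obtain k where k: "k < j" "exchange (es ! i) (es ! j) (es ! k)"
    using assms(1) unfolding exchange_order_def by auto
  have "es ! k \<subseteq> V" using sub j k(1) by auto
  then have "(V - es ! j) - (V - es ! k) = es ! k - es ! j" by blast
  then show "\<exists>k<j. card (map (\<lambda>e. V - e) es ! j - map (\<lambda>e. V - e) es ! k) = 1 \<and>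
      map (\<lambda>e. V - e) es ! i \<inter> map (\<lambda>e. V - e) es ! j \<subseteq> map (\<lambda>e. V - e) es ! k \<and>
      map (\<lambda>e. V - e) es ! k \<subseteq> map (\<lambda>e. V - e) es ! i \<union> map (\<lambda>e. V - e) es ! j"
    using k i j unfolding exchange_def by (intro exI[of _ k]) auto
qed

lemma minor_of_trans:
  assumes "minor_of D M" and "minor_of C D"
  shows "minor_of C M"
  using assms by induction (auto intro: minor_of.intros)

lemma W_chordal_minor: "W_chordal C \<Longrightarrow> minor_of C D \<Longrightarrow> W_chordal D"
  unfolding W_chordal_def by (blast intro: minor_of_trans)

lemma edges_d_complement_deletion:
  "edges (d_complement d (deletion C v)) = {e \<in> edges (d_complement d C). v \<notin> e}"
  by (auto simp: d_complement_def deletion_def)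

text \<open>By \<open>ge\<close>, every set \<open>e - {v}\<close> has at least \<open>d\<close>
  elements. One of size exactly \<open>d\<close> is therefore automatically minimal, and it comes
  from an edge through \<open>v\<close>, since edges avoiding \<open>v\<close> keep their size of at
  least \<open>Suc d\<close>.\<close>

lemma edges_d_complement_contraction:
  assumes fin: "finite (verts C)" and v: "v \<in> verts C"
    and ge: "\<And>e. e \<in> edges C \<Longrightarrow> Suc d \<le> card e"
  shows "insert v ` edges (d_complement d (contraction C v)) =
    {e \<in> edges (d_complement (Suc d) C). v \<in> e}"
proof -
  have edge: "f \<in> edges (contraction C v) \<longleftrightarrow> insert v f \<in> edges C"
    if f: "f \<subseteq> verts C - {v}" "card f = d" for f
  proof
    assume "f \<in> edges (contraction C v)"
    then obtain e where e: "e \<in> edges C" "f = e - {v}"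
      by (auto simp: contraction_def minimal_sets_def)
    then have "v \<in> e" using ge[of e] f(2) by (cases "v \<in> e") auto
    then show "insert v f \<in> edges C" using e by (simp add: insert_absorb)
  next
    assume "insert v f \<in> edges C"
    moreover have "f = insert v f - {v}" using f by auto
    ultimately have "f \<in> (\<lambda>e. e - {v}) ` edges C" by (rule rev_image_eqI)
    moreover have "e - {v} = f" if "e \<in> edges C" "e - {v} \<subseteq> f" for e
    proof (rule card_seteq)
      show "finite f" using f(1) fin finite_subset by blast
      show "card f \<le> card (e - {v})" using ge[OF that(1)] f(2) by (auto simp: card_Diff_singleton_if)
    qed (rule that(2))
    ultimately show "f \<in> edges (contraction C v)"
      by (auto simp: contraction_def minimal_sets_def)
  qed
  have verts: "verts (contraction C v) = verts C - {v}" by (simp add: contraction_def)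
  show ?thesis
  proof (intro set_eqI iffI)
    fix e assume "e \<in> insert v ` edges (d_complement d (contraction C v))"
    then obtain f where f: "e = insert v f" "f \<subseteq> verts C - {v}" "card f = d"
        "f \<notin> edges (contraction C v)"
      by (auto simp: d_complement_def verts)
    moreover have "finite f" "v \<notin> f" using f(2) fin finite_subset by blast+
    ultimately show "e \<in> {e \<in> edges (d_complement (Suc d) C). v \<in> e}"
      using edge[of f] v by (auto simp: d_complement_def)
  next
    fix e assume "e \<in> {e \<in> edges (d_complement (Suc d) C). v \<in> e}"
    then have e: "e \<subseteq> verts C" "card e = Suc d" "e \<notin> edges C" "v \<in> e"
      by (auto simp: d_complement_def)
    then have "e - {v} \<subseteq> verts C - {v}" "card (e - {v}) = d" "insert v (e - {v}) = e"
      by auto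
    then show "e \<in> insert v ` edges (d_complement d (contraction C v))"
      using edge[of "e - {v}"] e(3)
      by (intro image_eqI[of _ _ "e - {v}"]) (auto simp: d_complement_def verts)
  qed
qed

lemma simplicial_vertex_exchange:
  assumes fin: "finite (verts C)" and simp: "simplicial_vertex C v"
    and ge: "\<And>e. e \<in> edges C \<Longrightarrow> d \<le> card e"
    and x: "x \<in> edges (d_complement d C)" "v \<in> x"
    and y: "y \<in> edges (d_complement d C)" "v \<notin> y"
  shows "\<exists>z\<in>edges (d_complement d C). v \<in> z \<and> exchange x y z"
proof (rule ccontr)
  assume neg: "\<not> ?thesis"
  have sub: "x \<subseteq> verts C" "y \<subseteq> verts C" and card: "card x = d" "card y = d"
    and "y \<notin> edges C"
    using x y by (auto simp: d_complement_def)
  have fins: "finite x" "finite y" using sub fin finite_subset by blast+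
  \<comment> \<open>The candidates for \<open>z\<close>: swap an element \<open>u\<close> of
    \<open>y\<close> for \<open>v\<close>.\<close>
  define g where "g u = insert v (y - {u})" for u
  \<comment> \<open>Otherwise \<open>g u\<close> is a non-edge and a valid witness:
    \<open>u \<notin> x\<close> gives \<open>x \<inter> y \<subseteq> g u\<close>, and
    \<open>v \<in> x\<close> gives \<open>g u \<subseteq> x \<union> y\<close>.\<close>
  have g: "g u \<in> edges C" if u: "u \<in> y - x" for u
  proof (rule ccontr)
    assume "g u \<notin> edges C"
    moreover have "card (g u) = d"
      using u y(2) fins card card_Suc_Diff1[of y u] by (simp add: g_def)
    ultimately have "g u \<in> edges (d_complement d C)"
      using sub x by (auto simp: d_complement_def g_def)
    moreover have "g u - y = {v}" using y(2) by (auto simp: g_def)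
    then have "exchange x y (g u)" using u x(2) by (auto simp: exchange_def g_def)
    ultimately show False using neg by (auto simp: g_def)
  qed
  \<comment> \<open>Both sets have size \<open>d\<close>, so inclusion would mean equality, but only
    \<open>x\<close> contains \<open>v\<close>.\<close>
  have "\<not> y \<subseteq> x"
    using card_subset_eq[OF fins(1), of y] card x(2) y(2) by auto
  then obtain u where u: "u \<in> y" "u \<notin> x" by blast
  show False
  proof (cases "y - x = {u}")
    case True
    have "g u \<subseteq> x" using True x(2) by (auto simp: g_def)
    moreover have "card (g u) = d"
      using u y(2) fins card card_Suc_Diff1[of y u] by (simp add: g_def)
    ultimately have "g u = x" using card_subset_eq[OF fins(1)] card by metis
    then show False using g[of u] u x(1) by (auto simp: d_complement_def)
  next
    case False
    then obtain u' where u': "u' \<in> y" "u' \<notin> x" "u' \<noteq> u" using u by blast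
    \<comment> \<open>Simpliciality applies to distinct edges; \<open>u'\<close> separates these
      two.\<close>
    have "u' \<in> g u - g u'" using u' y(2) by (auto simp: g_def)
    then have "g u \<noteq> g u'" by blast
    moreover have "g u \<in> edges C" "g u' \<in> edges C" "v \<in> g u" "v \<in> g u'"
      using g u u' by (auto simp: g_def)
    ultimately
    obtain e where e: "e \<in> edges C" "e \<subseteq> g u \<union> g u' - {v}"
      using simp unfolding simplicial_vertex_def by meson
    then have "e \<subseteq> y" by (auto simp: g_def)
    then have "e = y" using card_seteq[OF fins(2)] ge[OF e(1)] card by metis
    then show False using e(1) \<open>y \<notin> edges C\<close> by simp
  qed
qed

text \<open>A lower bound on edge sizes passes to both minors, whereas a minimum does not: deletion
  may remove all edges of size \<open>d\<close>.\<close>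

lemma W_chordal_exchange_order:
  assumes "finite (verts C)" and "W_chordal C" and "\<And>e. e \<in> edges C \<Longrightarrow> d \<le> card e"
  shows "\<exists>es. exchange_order es \<and> set es = edges (d_complement d C)"
  using assms
proof (induction "card (verts C)" arbitrary: C d rule: less_induct)
  case less
  note fin = less.prems(1) and ge = less.prems(3)
  let ?E = "edges (d_complement d C)"
  show ?case
  proof (cases "verts C = {} \<or> d = 0")
    case True
    \<comment> \<open>The only possible non-edge is the empty set; finiteness excludes infinite
      sets, whose \<open>card\<close> is 0 by convention.\<close>
    then have "?E \<subseteq> {{}}"
      using fin by (auto simp: d_complement_def dest: finite_subset)
    then have "set [] = ?E \<or> set [{}] = ?E" by auto
    moreover have "exchange_order []" "exchange_order [{}]"
      by (auto simp: exchange_order_def)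
    ultimately show ?thesis by blast
  next
    case False
    then obtain c where d: "d = Suc c" by (cases d) auto
    obtain v where v: "simplicial_vertex C v"
      using False less.prems(2) minor_of.refl unfolding W_chordal_def by blast
    then have vC: "v \<in> verts C" by (simp add: simplicial_vertex_def)
    then have smaller: "card (verts C - {v}) < card (verts C)"
      using fin by (meson card_Diff1_less)
    have "\<exists>ys. exchange_order ys \<and> set ys = edges (d_complement d (deletion C v))"
    proof (rule less.hyps)
      show "W_chordal (deletion C v)"
        by (rule W_chordal_minor[OF less.prems(2)]) (intro minor_of.intros vC)
    qed (use smaller fin ge in \<open>auto simp: deletion_def\<close>)
    then obtain ys where ys: "exchange_order ys" "set ys = {e \<in> ?E. v \<notin> e}"
      by (auto simp: edges_d_complement_deletion)
    have "\<exists>xs. exchange_order xs \<and> set xs = edges (d_complement c (contraction C v))"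
    proof (rule less.hyps)
      show "W_chordal (contraction C v)"
        by (rule W_chordal_minor[OF less.prems(2)]) (intro minor_of.intros vC)
      fix f assume "f \<in> edges (contraction C v)"
      then obtain e where "e \<in> edges C" "f = e - {v}"
        by (auto simp: contraction_def minimal_sets_def)
      \<comment> \<open>Removing \<open>v\<close> costs at most one element, matching the drop from
        \<open>d\<close> to \<open>c\<close>.\<close>
      then show "c \<le> card f" using ge[of e] d by (auto simp: card_Diff_singleton_if)
    qed (use smaller fin in \<open>auto simp: contraction_def\<close>)
    then obtain xs where xs: "exchange_order xs"
        "set xs = edges (d_complement c (contraction C v))" by blast
    have xs_set: "set (map (insert v) xs) = {e \<in> ?E. v \<in> e}"
      using edges_d_complement_contraction[OF fin vC, of c] ge xs(2) d by simp
    \<comment> \<open>The sets through \<open>v\<close> come first because the mixed exchange brings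
      \<open>v\<close> into \<open>y\<close>, so its result lies in that block.\<close>
    have "exchange_order (map (insert v) xs @ ys)"
    proof (rule exchange_order_append)
      show "exchange_order (map (insert v) xs)"
        using xs by (intro exchange_order_map_insert)
          (auto simp: d_complement_def contraction_def)
      show "\<exists>z\<in>set (map (insert v) xs). exchange x y z"
        if "x \<in> set (map (insert v) xs)" "y \<in> set ys" for x y
        using that simplicial_vertex_exchange[OF fin v ge, of x y]
        unfolding xs_set ys(2) by blast
      show "set (map (insert v) xs) \<inter> set ys = {}" unfolding xs_set ys(2) by blast
    qed (rule ys(1))
    moreover have "set (map (insert v) xs @ ys) = ?E"
      unfolding set_append xs_set ys(2) by blast
    ultimately show ?thesis by blast
  qed
qed

theorem theorem3p2:
  fixes C :: "'a set_system" and d :: nat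
  assumes "clutter C"
    and "W_chordal C"
    and "edges C \<noteq> {}"
    and "d = Min (card ` edges C)"
  shows "strongly_shellable (alexander_dual (verts C) (independence_complex (d_complement d C)))"
proof -
  have fin: "finite (verts C)" and "edges C \<subseteq> Pow (verts C)"
    using assms(1) by (auto simp: clutter_def)
  \<comment> \<open>Finiteness makes \<open>Min\<close> a lower bound for the edge sizes.\<close>
  then have "finite (edges C)" by (meson finite_Pow_iff finite_subset)
  then have "d \<le> card e" if "e \<in> edges C" for e using that assms(4) by simp
  then obtain es where es: "exchange_order es" "set es = edges (d_complement d C)"
    using W_chordal_exchange_order[OF fin assms(2)] by blast
  show ?thesis
  proof (rule strongly_shellable_complements[OF es(1)])
    show "e \<subseteq> verts C" if "e \<in> set es" for e
      using that es(2) by (auto simp: d_complement_def)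
  qed (simp add: es(2) facets_alexander_dual_d_complement[OF fin])
qed

end
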